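(* Let $X$ be a finite simplicial complex, $d\ge0$, and suppose $\ker(B_{d+1})=0$ (there are no nonzero $(d+1)$-cycles). Let $F:C_{d+1}(X)\to C_{d+1}(X)$ be a smooth vector field and $G^{\uparrow}=B_{d+1}FB_{d+1}^\intercal$. Then there is a bijection between the fixed points of the restriction $G^{\uparrow}|_{\operatorname{im}(B_{d+1})}:\operatorname{im}(B_{d+1})\to\operatorname{im}(B_{d+1})$ and those of $F$. If $F$ is moreover componentwise, then this bijection preserves stability, i.e. the numbers of positive, zero and negative eigenvalues of the corresponding linearized systems.
   Context: A finite simplicial complex $X$ on vertex set $\{1,\dots,n\}$ is a collection of nonempty subsets closed under taking nonempty subsets; $X_d$ is the set of simplices with $d+1$ vertices; a $d$-simplex with vertices $i_0<\dots<i_d$ is written $[i_0,\dots,i_d]$. $C_d(X)$ is the real vector space with basis $X_d$ and inner product making $X_d$ orthonormal. The boundary map is $\partial_d[i_0,\dots,i_d]=\sum_{k=0}^d(-1)^k[i_0,\dots,\widehat{i_k},\dots,i_d]$ with matrix $B_d$; $B_d^\intercal$ its transpose. A fixed point of a vector field is a zero of it. $F$ is componentwise if $(F(x))_s$ depends only on $x_s$ for each $s\in X_{d+1}$. *)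

theory Defs
  imports "HOL-Analysis.Analysis"
begin

section \<open>Simplicial complexes and boundary matrices\<close>

text \<open>A finite simplicial complex on vertex set {1..n}: a collection of nonempty
  subsets of {1..n} closed under taking nonempty subsets.\<close>
definition simplicial_complex :: "nat \<Rightarrow> nat set set \<Rightarrow> bool" where
  "simplicial_complex n X \<longleftrightarrow>
     (\<forall>s\<in>X. s \<noteq> {} \<and> s \<subseteq> {1..n}) \<and>
     (\<forall>s\<in>X. \<forall>t. t \<subseteq> s \<and> t \<noteq> {} \<longrightarrow> t \<in> X)"

text \<open>X_d: the d-simplices, i.e. simplices with d+1 vertices.\<close>
definition simplices :: "nat set set \<Rightarrow> nat \<Rightarrow> nat set set" where
  "simplices X d = {s \<in> X. card s = d + 1}"

text \<open>Coefficient of the face t in the boundary of s = [i_0,...,i_k]: if t is s with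
  the vertex i_j removed then (-1)^j, where j = number of vertices of s below i_j;
  otherwise 0.\<close>
definition boundary_coeff :: "nat set \<Rightarrow> nat set \<Rightarrow> real" where
  "boundary_coeff t s =
     (if t \<subseteq> s \<and> card s = card t + 1
      then (-1) ^ card {u \<in> s. u < the_elem (s - t)} else 0)"

text \<open>Matrix of the boundary map C_{d+1}(X) \<rightarrow> C_d(X), where the rows are indexed
  by the d-simplices via the enumeration enum_r and the columns by the (d+1)-simplices
  via the enumeration enum_c (so the standard bases are the simplex bases).\<close>
definition boundary_matrix ::
  "('r::finite \<Rightarrow> nat set) \<Rightarrow> ('c::finite \<Rightarrow> nat set) \<Rightarrow> real^'c^'r" where
  "boundary_matrix enum_r enum_c = (\<chi> i j. boundary_coeff (enum_r i) (enum_c j))"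

section \<open>Smoothness\<close>

text \<open>Iterated directional (Frechet) derivatives of F.\<close>
inductive iter_dderiv :: "('a::real_normed_vector \<Rightarrow> 'b::real_normed_vector) \<Rightarrow> ('a \<Rightarrow> 'b) \<Rightarrow> bool"
  for F where
  base: "iter_dderiv F F"
| step: "iter_dderiv F G \<Longrightarrow> (\<forall>x. G differentiable (at x)) \<Longrightarrow>
         iter_dderiv F (\<lambda>x. frechet_derivative G (at x) v)"

text \<open>F is smooth (C^\<infinity>): all iterated derivatives exist everywhere.\<close>
definition smooth :: "('a::real_normed_vector \<Rightarrow> 'b::real_normed_vector) \<Rightarrow> bool" where
  "smooth F \<longleftrightarrow> (\<forall>G. iter_dderiv F G \<longrightarrow> (\<forall>x. G differentiable (at x)))"

text \<open>Componentwise vector field: (F x)_s depends only on x_s.\<close>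
definition componentwise :: "(real^'n \<Rightarrow> real^'n) \<Rightarrow> bool" where
  "componentwise F \<longleftrightarrow> (\<forall>x y s. x $ s = y $ s \<longrightarrow> F x $ s = F y $ s)"

section \<open>Eigenvalue counts (with algebraic multiplicity) of a linear map on a subspace\<close>

text \<open>Generalized eigenspace of L restricted to the subspace V for the real eigenvalue mu;
  its dimension is the algebraic multiplicity of mu.\<close>
definition gen_eigenspace :: "('a::real_vector \<Rightarrow> 'a) \<Rightarrow> 'a set \<Rightarrow> real \<Rightarrow> 'a set" where
  "gen_eigenspace L V mu = {v \<in> V. \<exists>k. ((\<lambda>w. L w - mu *\<^sub>R w) ^^ k) v = 0}"

text \<open>(number of positive, number of zero, number of negative) eigenvalues of L on V,
  counted with algebraic multiplicity.\<close>
definition inertia :: "('a::euclidean_space \<Rightarrow> 'a) \<Rightarrow> 'a set \<Rightarrow> nat \<times> nat \<times> nat" where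
  "inertia L V =
     (dim (span (\<Union>mu\<in>{mu. mu > 0}. gen_eigenspace L V mu)),
      dim (gen_eigenspace L V 0),
      dim (span (\<Union>mu\<in>{mu. mu < 0}. gen_eigenspace L V mu)))"

end

(* Since B is injective, B^T maps im B bijectively onto C_{d+1}, and B F (B^T x) = 0 iff
   F (B^T x) = 0; so B^T matches the zeros of G on im B with the zeros of F.  The linearisation
   of G at x is B J B^T with J = DF (B^T x).  For componentwise F the Jacobian J is diagonal,
   hence self-adjoint, and B^T carries the quadratic form of B J B^T on im B to that of J, since
   v . B J B^T v = B^T v . J B^T v.  Sylvester's law of inertia then gives equal inertia.  It is
   proved from the spectral theorem on invariant subspaces: the number of eigenvalues of a given
   sign is the largest dimension of a subspace on which the form is definite of that sign. *)

theory Submission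
  imports Defs
begin

section \<open>The spectral theorem on invariant subspaces\<close>

lemma quadratic_nonneg_imp_linear_coeff_zero:
  fixes a c :: real
  assumes "\<And>t. 0 \<le> 2 * t * a + t\<^sup>2 * c"
  shows "a = 0"
proof (rule ccontr)
  assume "a \<noteq> 0"
  define k where "k = \<bar>c\<bar> + 1"
  have "k > 0" "c < 2 * k" unfolding k_def by auto
  have "2 * (- a / k) * a + (- a / k)\<^sup>2 * c = a\<^sup>2 * (c - 2 * k) / k\<^sup>2"
    using \<open>k > 0\<close> by (simp add: field_simps power2_eq_square)
  also have "\<dots> < 0"
    using \<open>a \<noteq> 0\<close> \<open>k > 0\<close> \<open>c < 2 * k\<close> by (intro divide_neg_pos mult_pos_neg) auto
  finally show False using assms[of "- a / k"] by simp
qed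

definition self_adjoint :: "('a::real_inner \<Rightarrow> 'a) \<Rightarrow> bool" where
  "self_adjoint A \<longleftrightarrow> (\<forall>x y. A x \<bullet> y = x \<bullet> A y)"

lemma self_adjoint_imp_linear:
  assumes "self_adjoint A"
  shows "linear A"
proof (rule linearI)
  have sym: "x \<bullet> A y = A x \<bullet> y" for x y using assms by (simp add: self_adjoint_def)
  show "A (y + z) = A y + A z" for y z
  proof -
    have "w \<bullet> (A (y + z) - (A y + A z)) = 0" for w
      by (simp add: sym inner_diff_right inner_add_right)
    from this[of "A (y + z) - (A y + A z)"] show ?thesis by simp
  qed
  show "A (r *\<^sub>R y) = r *\<^sub>R A y" for r y
  proof -
    have "w \<bullet> (A (r *\<^sub>R y) - r *\<^sub>R A y) = 0" for w
      by (simp add: sym inner_diff_right)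
    from this[of "A (r *\<^sub>R y) - r *\<^sub>R A y"] show ?thesis by simp
  qed
qed

lemma rayleigh_quotient_max_exists:
  fixes A :: "'a::euclidean_space \<Rightarrow> 'a"
  assumes "linear A" "subspace V" "V \<noteq> {0}"
  obtains x0 where "x0 \<in> V" "norm x0 = 1" "\<And>x. x \<in> V \<Longrightarrow> x \<bullet> A x \<le> (x0 \<bullet> A x0) * (x \<bullet> x)"
proof -
  define S where "S = V \<inter> sphere 0 1"
  have "compact S"
    unfolding S_def by (metis assms(2) closed_subspace compact_Int_closed compact_sphere inf_commute)
  moreover obtain v where v: "v \<in> V" "v \<noteq> 0" using assms(2,3) subspace_0 by blast
  then have "v /\<^sub>R norm v \<in> S" unfolding S_def using assms(2) by (simp add: subspace_scale)
  moreover have "continuous_on S (\<lambda>x. x \<bullet> A x)"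
    using assms(1) by (intro continuous_intros linear_continuous_on) (simp add: linear_conv_bounded_linear)
  ultimately obtain x0 where x0: "x0 \<in> S" and max: "\<And>u. u \<in> S \<Longrightarrow> u \<bullet> A u \<le> x0 \<bullet> A x0"
    using continuous_attains_sup[of S "\<lambda>x. x \<bullet> A x"] by blast
  have "x \<bullet> A x \<le> (x0 \<bullet> A x0) * (x \<bullet> x)" if "x \<in> V" for x
  proof (cases "x = 0")
    case True
    then show ?thesis using assms(1) by (simp add: linear_0)
  next
    case False
    then have "x /\<^sub>R norm x \<in> S" unfolding S_def using that assms(2) by (simp add: subspace_scale)
    then have "(x /\<^sub>R norm x) \<bullet> A (x /\<^sub>R norm x) \<le> x0 \<bullet> A x0" by (rule max)
    moreover have "(x /\<^sub>R norm x) \<bullet> A (x /\<^sub>R norm x) = (x \<bullet> A x) / (x \<bullet> x)"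
      using assms(1) False by (simp add: linear_scale dot_square_norm power2_eq_square field_simps)
    ultimately show ?thesis using False by (simp add: divide_le_eq mult.commute)
  qed
  with x0 that show ?thesis unfolding S_def by auto
qed

text \<open>With \<open>lam = x0 \<bullet> A x0\<close>, the function \<open>t \<mapsto> lam |x0 + t y|\<^sup>2 - (x0 + t y) \<bullet> A (x0 + t y)\<close>
  is nonnegative and vanishes at \<open>t = 0\<close>, so its linear coefficient vanishes; for
  \<open>y = lam x0 - A x0\<close> that coefficient is \<open>2 |y|\<^sup>2\<close>.\<close>
lemma rayleigh_quotient_maximiser_is_eigenvector:
  fixes A :: "'a::euclidean_space \<Rightarrow> 'a"
  assumes sa: "self_adjoint A" and V: "subspace V" "A ` V \<subseteq> V"
    and x0: "x0 \<in> V" "norm x0 = 1"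
    and max: "\<And>x. x \<in> V \<Longrightarrow> x \<bullet> A x \<le> (x0 \<bullet> A x0) * (x \<bullet> x)"
  shows "A x0 = (x0 \<bullet> A x0) *\<^sub>R x0"
proof -
  define lam where "lam = x0 \<bullet> A x0"
  define y where "y = lam *\<^sub>R x0 - A x0"
  have lin: "linear A" using sa by (rule self_adjoint_imp_linear)
  have "y \<in> V" unfolding y_def using x0(1) V by (auto intro: subspace_diff subspace_scale)
  have "0 \<le> 2 * t * (y \<bullet> y) + t\<^sup>2 * (y \<bullet> (lam *\<^sub>R y - A y))" for t
  proof -
    have "x0 + t *\<^sub>R y \<in> V" using x0(1) \<open>y \<in> V\<close> V by (simp add: subspace_add subspace_scale)
    from max[OF this] have "0 \<le> lam * ((x0 + t *\<^sub>R y) \<bullet> (x0 + t *\<^sub>R y)) - (x0 + t *\<^sub>R y) \<bullet> A (x0 + t *\<^sub>R y)"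
      by (simp add: lam_def)
    also have "(x0 + t *\<^sub>R y) \<bullet> (x0 + t *\<^sub>R y) = 1 + 2 * t * (x0 \<bullet> y) + t\<^sup>2 * (y \<bullet> y)"
      using x0(2) by (simp add: norm_eq_1 inner_add_left inner_add_right power2_eq_square algebra_simps inner_commute)
    also have "(x0 + t *\<^sub>R y) \<bullet> A (x0 + t *\<^sub>R y) = lam + 2 * t * (A x0 \<bullet> y) + t\<^sup>2 * (y \<bullet> A y)"
      using lin sa unfolding self_adjoint_def lam_def
      by (simp add: linear_add linear_scale inner_add_left inner_add_right power2_eq_square algebra_simps inner_commute)
    also have "lam * (1 + 2 * t * (x0 \<bullet> y) + t\<^sup>2 * (y \<bullet> y)) - (lam + 2 * t * (A x0 \<bullet> y) + t\<^sup>2 * (y \<bullet> A y))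
        = 2 * t * (y \<bullet> y) + t\<^sup>2 * (y \<bullet> (lam *\<^sub>R y - A y))"
      unfolding y_def by (simp add: inner_diff_left inner_diff_right algebra_simps inner_commute)
    finally show ?thesis .
  qed
  then have "y \<bullet> y = 0" by (rule quadratic_nonneg_imp_linear_coeff_zero)
  then show ?thesis unfolding y_def lam_def by simp
qed

lemma self_adjoint_eigenvector_exists:
  fixes A :: "'a::euclidean_space \<Rightarrow> 'a"
  assumes "self_adjoint A" "subspace V" "A ` V \<subseteq> V" "V \<noteq> {0}"
  obtains x lam where "x \<in> V" "norm x = 1" "A x = lam *\<^sub>R x"
proof -
  obtain x0 where "x0 \<in> V" "norm x0 = 1" "\<And>x. x \<in> V \<Longrightarrow> x \<bullet> A x \<le> (x0 \<bullet> A x0) * (x \<bullet> x)"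
    using rayleigh_quotient_max_exists[OF self_adjoint_imp_linear[OF assms(1)] assms(2,4)] by blast
  with rayleigh_quotient_maximiser_is_eigenvector[OF assms(1-3)] that show ?thesis by blast
qed

definition orthogonal_eigenbasis :: "('a::real_inner \<Rightarrow> 'a) \<Rightarrow> 'a set \<Rightarrow> 'a set \<Rightarrow> ('a \<Rightarrow> real) \<Rightarrow> bool"
  where "orthogonal_eigenbasis A V E lam \<longleftrightarrow>
    finite E \<and> 0 \<notin> E \<and> pairwise orthogonal E \<and> span E = V \<and> (\<forall>b\<in>E. A b = lam b *\<^sub>R b)"

lemma orthogonal_eigenbasis_insert:
  assumes V: "subspace V" and x0: "x0 \<in> V" "x0 \<bullet> x0 = 1" "A x0 = lam0 *\<^sub>R x0"
    and E': "orthogonal_eigenbasis A {x \<in> V. x \<bullet> x0 = 0} E' lam'"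
  shows "orthogonal_eigenbasis A V (insert x0 E') (lam'(x0 := lam0))"
  unfolding orthogonal_eigenbasis_def
proof (intro conjI)
  define V' where "V' = {x \<in> V. x \<bullet> x0 = 0}"
  have E'V': "E' \<subseteq> V'" using E' span_superset unfolding V'_def orthogonal_eigenbasis_def by blast
  then have "x0 \<notin> E'" using x0(2) unfolding V'_def by auto
  show "finite (insert x0 E')" "0 \<notin> insert x0 E'"
    using E' x0(2) unfolding orthogonal_eigenbasis_def by auto
  show "pairwise orthogonal (insert x0 E')"
    using E' E'V' unfolding orthogonal_eigenbasis_def pairwise_insert V'_def
    by (auto simp: orthogonal_def inner_commute)
  show "\<forall>b\<in>insert x0 E'. A b = (lam'(x0 := lam0)) b *\<^sub>R b"
    using E' x0(3) \<open>x0 \<notin> E'\<close> unfolding orthogonal_eigenbasis_def by auto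
  show "span (insert x0 E') = V"
  proof
    show "span (insert x0 E') \<subseteq> V"
      using E'V' x0(1) V unfolding V'_def by (intro span_minimal) auto
    show "V \<subseteq> span (insert x0 E')"
    proof
      fix v assume "v \<in> V"
      then have "v - (v \<bullet> x0) *\<^sub>R x0 \<in> V'"
        using x0 V unfolding V'_def by (simp add: inner_diff_left subspace_diff subspace_scale)
      moreover have "span E' \<subseteq> span (insert x0 E')" by (rule span_mono) auto
      ultimately have "v - (v \<bullet> x0) *\<^sub>R x0 \<in> span (insert x0 E')"
        using E' unfolding V'_def orthogonal_eigenbasis_def by auto
      moreover have "(v \<bullet> x0) *\<^sub>R x0 \<in> span (insert x0 E')"
        by (simp add: span_base span_scale)
      ultimately have "(v - (v \<bullet> x0) *\<^sub>R x0) + (v \<bullet> x0) *\<^sub>R x0 \<in> span (insert x0 E')"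
        by (rule span_add)
      then show "v \<in> span (insert x0 E')" by simp
    qed
  qed
qed

text \<open>The spectral theorem on an invariant subspace, by induction on its dimension: split off a
  unit eigenvector and recurse into its orthogonal complement, which is again invariant.\<close>
lemma orthogonal_eigenbasis_exists:
  fixes A :: "'a::euclidean_space \<Rightarrow> 'a"
  assumes sa: "self_adjoint A"
  shows "subspace V \<Longrightarrow> A ` V \<subseteq> V \<Longrightarrow> \<exists>E lam. orthogonal_eigenbasis A V E lam"
proof (induction "dim V" arbitrary: V rule: less_induct)
  case less
  show ?case
  proof (cases "V = {0}")
    case True
    then show ?thesis by (auto simp: orthogonal_eigenbasis_def intro!: exI[of _ "{}"])
  next
    case False
    obtain x0 lam0 where x0: "x0 \<in> V" "norm x0 = 1" "A x0 = lam0 *\<^sub>R x0"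
      using self_adjoint_eigenvector_exists[OF sa less.prems False] by blast
    have x0x0: "x0 \<bullet> x0 = 1" using x0(2) by (simp add: norm_eq_1)
    define V' where "V' = {x \<in> V. x \<bullet> x0 = 0}"
    have "subspace V'" using less.prems(1) unfolding V'_def subspace_def by (auto simp: inner_add_left)
    moreover have "A ` V' \<subseteq> V'"
      using sa less.prems(2) x0(3) unfolding V'_def self_adjoint_def by auto
    moreover have "dim V' < dim V"
    proof (rule dim_psubset)
      have "x0 \<notin> V'" "V' \<subseteq> V" using x0x0 unfolding V'_def by auto
      then have "V' \<subset> V" using x0(1) by blast
      then show "span V' \<subset> span V" using \<open>subspace V'\<close> less.prems(1) by (metis span_eq_iff)
    qed
    ultimately obtain E' lam' where "orthogonal_eigenbasis A V' E' lam'"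
      using less.hyps by blast
    then have "orthogonal_eigenbasis A V (insert x0 E') (lam'(x0 := lam0))"
      using orthogonal_eigenbasis_insert[where A=A, OF less.prems(1) x0(1) x0x0 x0(3)] unfolding V'_def by blast
    then show ?thesis by blast
  qed
qed

lemma orthogonal_expansion:
  fixes E :: "'a::euclidean_space set"
  assumes "finite E" "0 \<notin> E" "pairwise orthogonal E" "v \<in> span E"
  shows "v = (\<Sum>b\<in>E. (v \<bullet> b / (b \<bullet> b)) *\<^sub>R b)"
proof -
  define w where "w = v - (\<Sum>b\<in>E. (v \<bullet> b / (b \<bullet> b)) *\<^sub>R b)"
  have "w \<in> span E" unfolding w_def
    by (intro span_diff assms(4) span_sum span_scale span_base)
  moreover have "orthogonal w c" if "c \<in> E" for c
  proof -
    have "(\<Sum>b\<in>E. (v \<bullet> b / (b \<bullet> b)) *\<^sub>R b) \<bullet> c = (\<Sum>b\<in>E. (v \<bullet> b / (b \<bullet> b)) * (b \<bullet> c))"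
      by (simp add: inner_sum_left)
    also have "\<dots> = (v \<bullet> c / (c \<bullet> c)) * (c \<bullet> c)"
      using assms(1,3) that
      by (subst sum.remove[of E c]) (auto simp: pairwise_def orthogonal_def intro!: sum.neutral)
    also have "\<dots> = v \<bullet> c" using that assms(2) by auto
    finally show ?thesis unfolding w_def orthogonal_def by (simp add: inner_diff_left)
  qed
  ultimately have "orthogonal w w" using orthogonal_to_span by blast
  then show ?thesis unfolding w_def orthogonal_def by simp
qed

lemma quadratic_form_orthogonal_eigenbasis:
  fixes A :: "'a::euclidean_space \<Rightarrow> 'a"
  assumes "self_adjoint A" "orthogonal_eigenbasis A V E lam" "w \<in> V"
  shows "w \<bullet> A w = (\<Sum>b\<in>E. lam b * (w \<bullet> b)\<^sup>2 / (b \<bullet> b))"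
proof -
  have E: "finite E" "0 \<notin> E" "pairwise orthogonal E" "span E = V" "\<forall>b\<in>E. A b = lam b *\<^sub>R b"
    using assms(2) unfolding orthogonal_eigenbasis_def by auto
  have "A w = A (\<Sum>b\<in>E. (w \<bullet> b / (b \<bullet> b)) *\<^sub>R b)"
    using orthogonal_expansion[OF E(1-3)] E(4) assms(3) by auto
  also have "\<dots> = (\<Sum>b\<in>E. (w \<bullet> b / (b \<bullet> b) * lam b) *\<^sub>R b)"
    using self_adjoint_imp_linear[OF assms(1)] E(5) by (simp add: linear_sum linear_scale)
  finally have "w \<bullet> A w = (\<Sum>b\<in>E. (w \<bullet> b / (b \<bullet> b) * lam b) * (w \<bullet> b))"
    by (simp add: inner_sum_right)
  also have "\<dots> = (\<Sum>b\<in>E. lam b * (w \<bullet> b)\<^sup>2 / (b \<bullet> b))"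
    by (simp add: power2_eq_square mult_ac)
  finally show ?thesis .
qed

lemma dim_span_orthogonal_eigenvectors:
  assumes "orthogonal_eigenbasis A V E lam" "S \<subseteq> E"
  shows "dim (span S) = card S"
proof -
  have "independent S" using assms unfolding orthogonal_eigenbasis_def
    by (metis pairwise_orthogonal_independent pairwise_subset subsetD)
  then show ?thesis by (simp add: dim_eq_card_independent)
qed

lemma inner_iterated_shift_eigenvector:
  assumes "self_adjoint A" "A b = l *\<^sub>R b"
  shows "((\<lambda>w. A w - mu *\<^sub>R w) ^^ k) v \<bullet> b = (l - mu) ^ k * (v \<bullet> b)"
  using assms by (induction k) (auto simp: self_adjoint_def inner_diff_left algebra_simps)

lemma gen_eigenspace_subset_span_eigenvectors:
  fixes A :: "'a::euclidean_space \<Rightarrow> 'a"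
  assumes sa: "self_adjoint A" and E: "orthogonal_eigenbasis A V E lam"
  shows "gen_eigenspace A V mu \<subseteq> span {b\<in>E. lam b = mu}"
proof
  fix v assume "v \<in> gen_eigenspace A V mu"
  then obtain k where v: "v \<in> V" "((\<lambda>w. A w - mu *\<^sub>R w) ^^ k) v = 0"
    unfolding gen_eigenspace_def by auto
  have orth: "v \<bullet> b = 0" if "b \<in> E" "lam b \<noteq> mu" for b
    using inner_iterated_shift_eigenvector[OF sa, where b=b and l="lam b" and mu=mu and k=k and v=v] E that v(2)
    unfolding orthogonal_eigenbasis_def by simp
  then have "(\<Sum>b\<in>E. (v \<bullet> b / (b \<bullet> b)) *\<^sub>R b) \<in> span {b\<in>E. lam b = mu}"
  proof (intro span_sum)
    fix b assume "b \<in> E"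
    then show "(v \<bullet> b / (b \<bullet> b)) *\<^sub>R b \<in> span {b\<in>E. lam b = mu}"
      using orth by (cases "lam b = mu") (auto intro: span_scale span_base span_zero)
  qed
  then show "v \<in> span {b\<in>E. lam b = mu}"
    using E v(1) orthogonal_expansion[of E v] unfolding orthogonal_eigenbasis_def by auto
qed

lemma inertia_eq_eigenvalue_counts:
  fixes A :: "'a::euclidean_space \<Rightarrow> 'a"
  assumes sa: "self_adjoint A" and E: "orthogonal_eigenbasis A V E lam"
  shows "inertia A V = (card {b\<in>E. lam b > 0}, card {b\<in>E. lam b = 0}, card {b\<in>E. lam b < 0})"
proof -
  have span_eq: "span (\<Union>mu\<in>{mu. P mu}. gen_eigenspace A V mu) = span {b\<in>E. P (lam b)}" for P
  proof (rule span_eq[THEN iffD2], intro conjI subsetI)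
    fix v assume "v \<in> (\<Union>mu\<in>{mu. P mu}. gen_eigenspace A V mu)"
    then obtain mu where "P mu" "v \<in> span {b\<in>E. lam b = mu}"
      using gen_eigenspace_subset_span_eigenvectors[OF sa E] by blast
    moreover have "span {b\<in>E. lam b = mu} \<subseteq> span {b\<in>E. P (lam b)}"
      using \<open>P mu\<close> by (intro span_mono) auto
    ultimately show "v \<in> span {b\<in>E. P (lam b)}" by blast
  next
    fix b assume b: "b \<in> {b\<in>E. P (lam b)}"
    then have "b \<in> V" "((\<lambda>w. A w - lam b *\<^sub>R w) ^^ 1) b = 0"
      using E span_superset unfolding orthogonal_eigenbasis_def by auto
    then have "b \<in> gen_eigenspace A V (lam b)" unfolding gen_eigenspace_def by blast
    then show "b \<in> span (\<Union>mu\<in>{mu. P mu}. gen_eigenspace A V mu)"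
      using b by (intro span_base) blast
  qed
  have dim_eq: "dim (span (\<Union>mu\<in>{mu. P mu}. gen_eigenspace A V mu)) = card {b\<in>E. P (lam b)}" for P
    unfolding span_eq by (rule dim_span_orthogonal_eigenvectors[OF E]) auto
  have "dim (gen_eigenspace A V 0) = card {b\<in>E. lam b = 0}"
    using dim_eq[of "\<lambda>mu. mu = 0"] by simp
  then show ?thesis
    unfolding inertia_def using dim_eq[of "\<lambda>mu. mu > 0"] dim_eq[of "\<lambda>mu. mu < 0"] by simp
qed

section \<open>Sylvester's law of inertia\<close>

lemma quadratic_form_span_eigenvectors:
  fixes A :: "'a::euclidean_space \<Rightarrow> 'a"
  assumes sa: "self_adjoint A" and E: "orthogonal_eigenbasis A V E lam"
    and S: "S \<subseteq> E" and w: "w \<in> span S"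
  shows "w \<bullet> A w = (\<Sum>b\<in>S. lam b * (w \<bullet> b)\<^sup>2 / (b \<bullet> b))"
proof -
  have "w \<in> V" using E S w span_mono unfolding orthogonal_eigenbasis_def by blast
  moreover have "w \<bullet> b = 0" if "b \<in> E - S" for b
  proof -
    have "orthogonal b w"
      by (rule orthogonal_to_span[OF w]) (use that S E in \<open>fastforce simp: orthogonal_eigenbasis_def pairwise_def\<close>)
    then show ?thesis by (simp add: orthogonal_def inner_commute)
  qed
  ultimately show ?thesis
    using quadratic_form_orthogonal_eigenbasis[OF sa E] S E
    by (simp add: orthogonal_eigenbasis_def sum.mono_neutral_right)
qed

lemma definite_on_span_eigenvectors:
  fixes A :: "'a::euclidean_space \<Rightarrow> 'a" and \<sigma> :: real
  assumes sa: "self_adjoint A" and E: "orthogonal_eigenbasis A V E lam"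
    and w: "w \<in> span {b\<in>E. \<sigma> * lam b > 0}" "w \<noteq> 0"
  shows "\<sigma> * (w \<bullet> A w) > 0"
proof -
  define P where "P = {b\<in>E. \<sigma> * lam b > 0}"
  have P: "finite P" "0 \<notin> P" using E unfolding P_def orthogonal_eigenbasis_def by auto
  obtain c where c: "c \<in> P" "w \<bullet> c \<noteq> 0"
    using orthogonal_to_span[of w P w] w unfolding P_def orthogonal_def by (auto simp: inner_commute)
  have "\<sigma> * (w \<bullet> A w) = (\<Sum>b\<in>P. \<sigma> * lam b * (w \<bullet> b)\<^sup>2 / (b \<bullet> b))"
    using quadratic_form_span_eigenvectors[OF sa E _ w(1)[folded P_def]]
    by (simp add: P_def sum_distrib_left mult.assoc)
  also have "\<dots> > 0"
  proof (rule sum_pos2[OF P(1) c(1)])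
    have "c \<bullet> c > 0" using c(1) P(2) by (metis inner_gt_zero_iff)
    then show "0 < \<sigma> * lam c * (w \<bullet> c)\<^sup>2 / (c \<bullet> c)" using c unfolding P_def by simp
    show "0 \<le> \<sigma> * lam b * (w \<bullet> b)\<^sup>2 / (b \<bullet> b)" if "b \<in> P" for b
      using that unfolding P_def by simp
  qed
  finally show ?thesis .
qed

lemma semidefinite_on_span_eigenvectors:
  fixes A :: "'a::euclidean_space \<Rightarrow> 'a" and \<sigma> :: real
  assumes sa: "self_adjoint A" and E: "orthogonal_eigenbasis A V E lam"
    and w: "w \<in> span {b\<in>E. \<not> \<sigma> * lam b > 0}"
  shows "\<sigma> * (w \<bullet> A w) \<le> 0"
proof -
  have "\<sigma> * (w \<bullet> A w) = (\<Sum>b\<in>{b\<in>E. \<not> \<sigma> * lam b > 0}. \<sigma> * lam b * (w \<bullet> b)\<^sup>2 / (b \<bullet> b))"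
    using quadratic_form_span_eigenvectors[OF sa E _ w] by (simp add: sum_distrib_left mult.assoc)
  also have "\<dots> \<le> 0"
    by (rule sum_nonpos) (simp add: divide_nonpos_nonneg mult_nonpos_nonneg)
  finally show ?thesis .
qed

text \<open>A subspace on which \<open>w \<mapsto> \<sigma> * (w \<bullet> A w)\<close> is positive definite meets the span of the
  remaining eigenvectors, where this form is \<open>\<le> 0\<close>, only in \<open>0\<close>; now count dimensions.\<close>
lemma dim_definite_subspace_le:
  fixes A :: "'a::euclidean_space \<Rightarrow> 'a" and \<sigma> :: real
  assumes sa: "self_adjoint A" and E: "orthogonal_eigenbasis A V E lam"
    and W: "subspace W" "W \<subseteq> V"
    and definite: "\<And>w. w \<in> W \<Longrightarrow> w \<noteq> 0 \<Longrightarrow> \<sigma> * (w \<bullet> A w) > 0"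
  shows "dim W \<le> card {b\<in>E. \<sigma> * lam b > 0}"
proof -
  define N where "N = span {b\<in>E. \<not> \<sigma> * lam b > 0}"
  have V: "subspace V" "V = span E" "finite E" using E unfolding orthogonal_eigenbasis_def by auto
  have "W \<inter> N \<subseteq> {0}"
  proof
    fix w assume w: "w \<in> W \<inter> N"
    then have "\<not> \<sigma> * (w \<bullet> A w) > 0"
      using semidefinite_on_span_eigenvectors[OF sa E] unfolding N_def by (simp add: not_less)
    then show "w \<in> {0}" using definite w by blast
  qed
  then have "dim (W \<inter> N) = 0" by simp
  moreover have "N \<subseteq> V" unfolding N_def V(2) by (rule span_mono) auto
  then have "{x + y |x y. x \<in> W \<and> y \<in> N} \<subseteq> V"
    using W(2) by (auto intro: subspace_add[OF V(1)])
  then have "dim {x + y |x y. x \<in> W \<and> y \<in> N} \<le> dim V" by (rule dim_subset)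
  moreover have "dim V = card E"
    unfolding V(2) by (rule dim_span_orthogonal_eigenvectors[OF E]) simp
  moreover have "subspace N" unfolding N_def by simp
  ultimately have "dim W + dim N \<le> card E"
    using dim_sums_Int[OF W(1) \<open>subspace N\<close>] by linarith
  moreover have "dim N = card {b\<in>E. \<not> \<sigma> * lam b > 0}"
    unfolding N_def by (rule dim_span_orthogonal_eigenvectors[OF E]) auto
  moreover have "card E = card {b\<in>E. \<sigma> * lam b > 0} + card {b\<in>E. \<not> \<sigma> * lam b > 0}"
  proof -
    have "card ({b\<in>E. \<sigma> * lam b > 0} \<union> {b\<in>E. \<not> \<sigma> * lam b > 0})
        = card {b\<in>E. \<sigma> * lam b > 0} + card {b\<in>E. \<not> \<sigma> * lam b > 0}"
      using V(3) by (intro card_Un_disjoint) auto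
    moreover have "{b\<in>E. \<sigma> * lam b > 0} \<union> {b\<in>E. \<not> \<sigma> * lam b > 0} = E" by auto
    ultimately show ?thesis by simp
  qed
  ultimately show ?thesis by linarith
qed

lemma sign_count_le_of_injective:
  fixes A1 :: "'a::euclidean_space \<Rightarrow> 'a" and A2 :: "'b::euclidean_space \<Rightarrow> 'b" and \<sigma> :: real
  assumes sa1: "self_adjoint A1" and E1: "orthogonal_eigenbasis A1 V1 E1 l1"
    and sa2: "self_adjoint A2" and E2: "orthogonal_eigenbasis A2 V2 E2 l2"
    and T: "linear T" "inj_on T V1" "T ` V1 \<subseteq> V2"
    and form: "\<And>v. v \<in> V1 \<Longrightarrow> T v \<bullet> A2 (T v) = v \<bullet> A1 v"
  shows "card {b\<in>E1. \<sigma> * l1 b > 0} \<le> card {b\<in>E2. \<sigma> * l2 b > 0}"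
proof -
  define W where "W = span {b\<in>E1. \<sigma> * l1 b > 0}"
  have WV1: "W \<subseteq> V1"
    using E1 span_mono[of "{b\<in>E1. \<sigma> * l1 b > 0}" E1] unfolding W_def orthogonal_eigenbasis_def by auto
  have "card {b\<in>E1. \<sigma> * l1 b > 0} = dim W"
    unfolding W_def by (rule dim_span_orthogonal_eigenvectors[OF E1, symmetric]) auto
  also have "\<dots> = dim (T ` W)"
    using T(2) WV1 unfolding W_def by (intro dim_image_eq[OF T(1), symmetric]) (metis span_span inj_on_subset)
  also have "\<dots> \<le> card {b\<in>E2. \<sigma> * l2 b > 0}"
  proof (rule dim_definite_subspace_le[OF sa2 E2])
    show "subspace (T ` W)" unfolding W_def using T(1) by (simp add: linear_subspace_image)
    show "T ` W \<subseteq> V2" using WV1 T(3) by blast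
    fix z assume "z \<in> T ` W" "z \<noteq> 0"
    then obtain w where "w \<in> W" "w \<noteq> 0" "z = T w" using T(1) linear_0 by blast
    then show "\<sigma> * (z \<bullet> A2 z) > 0"
      using definite_on_span_eigenvectors[OF sa1 E1] form WV1 unfolding W_def by auto
  qed
  finally show ?thesis .
qed

lemma card_partition_by_sign:
  fixes f :: "'a \<Rightarrow> real"
  assumes "finite E"
  shows "card E = card {b\<in>E. f b > 0} + card {b\<in>E. f b = 0} + card {b\<in>E. f b < 0}"
proof -
  have "card E = card ({b\<in>E. f b > 0} \<union> {b\<in>E. f b = 0} \<union> {b\<in>E. f b < 0})"
    by (rule arg_cong[where f=card]) auto
  also have "\<dots> = card ({b\<in>E. f b > 0} \<union> {b\<in>E. f b = 0}) + card {b\<in>E. f b < 0}"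
    using assms by (intro card_Un_disjoint) auto
  also have "card ({b\<in>E. f b > 0} \<union> {b\<in>E. f b = 0}) = card {b\<in>E. f b > 0} + card {b\<in>E. f b = 0}"
    using assms by (intro card_Un_disjoint) auto
  finally show ?thesis .
qed

theorem sylvester_law_of_inertia:
  fixes A1 :: "'a::euclidean_space \<Rightarrow> 'a" and A2 :: "'b::euclidean_space \<Rightarrow> 'b"
  assumes sa1: "self_adjoint A1" "subspace V1" "A1 ` V1 \<subseteq> V1"
    and sa2: "self_adjoint A2" "subspace V2" "A2 ` V2 \<subseteq> V2"
    and T: "linear T" "bij_betw T V1 V2"
    and form: "\<And>v. v \<in> V1 \<Longrightarrow> T v \<bullet> A2 (T v) = v \<bullet> A1 v"
  shows "inertia A1 V1 = inertia A2 V2"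
proof -
  obtain E1 l1 where E1: "orthogonal_eigenbasis A1 V1 E1 l1"
    using orthogonal_eigenbasis_exists[OF sa1] by blast
  obtain E2 l2 where E2: "orthogonal_eigenbasis A2 V2 E2 l2"
    using orthogonal_eigenbasis_exists[OF sa2] by blast
  have inj: "inj_on T V1" and img: "T ` V1 = V2" using T(2) by (auto simp: bij_betw_def)
  obtain g where g: "linear g" "g ` UNIV \<subseteq> V1" "\<And>v. v \<in> V1 \<Longrightarrow> g (T v) = v"
    using linear_exists_left_inverse_on[OF T(1) sa1(2) inj] by blast
  have count_eq: "card {b\<in>E1. \<sigma> * l1 b > 0} = card {b\<in>E2. \<sigma> * l2 b > 0}" for \<sigma>
  proof (rule antisym)
    show "card {b\<in>E1. \<sigma> * l1 b > 0} \<le> card {b\<in>E2. \<sigma> * l2 b > 0}"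
      using sign_count_le_of_injective[OF sa1(1) E1 sa2(1) E2 T(1) inj] img form by blast
    have "inj_on g V2" "g ` V2 \<subseteq> V1" "\<And>z. z \<in> V2 \<Longrightarrow> g z \<bullet> A1 (g z) = z \<bullet> A2 z"
      using g img form by (auto simp: inj_on_def)
    then show "card {b\<in>E2. \<sigma> * l2 b > 0} \<le> card {b\<in>E1. \<sigma> * l1 b > 0}"
      using sign_count_le_of_injective[OF sa2(1) E2 sa1(1) E1 g(1)] by blast
  qed
  have "card E1 = dim V1" "card E2 = dim V2"
    using dim_span_orthogonal_eigenvectors[OF E1, of E1] dim_span_orthogonal_eigenvectors[OF E2, of E2]
      E1 E2 by (auto simp: orthogonal_eigenbasis_def)
  moreover have "dim V2 = dim V1"
    using dim_image_eq[OF T(1), of V1] inj img span_eq_iff[THEN iffD2, OF sa1(2)] by simp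
  ultimately have "card E1 = card E2" by simp
  then have "card {b\<in>E1. l1 b = 0} = card {b\<in>E2. l2 b = 0}"
    using card_partition_by_sign[of E1 l1] card_partition_by_sign[of E2 l2] count_eq[of 1] count_eq[of "-1"]
      E1 E2 by (simp add: orthogonal_eigenbasis_def)
  then show ?thesis
    using inertia_eq_eigenvalue_counts[OF sa1(1) E1] inertia_eq_eigenvalue_counts[OF sa2(1) E2]
      count_eq[of 1] count_eq[of "-1"] by simp
qed

section \<open>Linearisations of componentwise fields and of B F B^T\<close>

lemma componentwise_derivative_diagonal:
  fixes F :: "real^'n \<Rightarrow> real^'n"
  assumes cw: "componentwise F" and F': "(F has_derivative J) (at y)"
  shows "J h $ s = h $ s * J (axis s 1) $ s"
proof -
  have lin: "linear J" using F' has_derivative_linear by blast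
  have line: "((\<lambda>t::real. F (y + t *\<^sub>R k) $ s) has_derivative (\<lambda>t. J (t *\<^sub>R k) $ s)) (at 0)" for k
  proof -
    have "((\<lambda>t::real. y + t *\<^sub>R k) has_derivative (\<lambda>t. t *\<^sub>R k)) (at 0)"
      by (auto intro!: derivative_eq_intros)
    from has_derivative_compose[OF this, of F J] F'
    have "((\<lambda>t::real. F (y + t *\<^sub>R k)) has_derivative (\<lambda>t. J (t *\<^sub>R k))) (at 0)" by simp
    from has_derivative_compose[OF this bounded_linear_imp_has_derivative[OF bounded_linear_vec_nth]]
    show ?thesis by simp
  qed
  define h' where "h' = (h $ s) *\<^sub>R axis s (1::real)"
  have "(y + t *\<^sub>R h) $ s = (y + t *\<^sub>R h') $ s" for t unfolding h'_def by simp
  then have "(\<lambda>t::real. F (y + t *\<^sub>R h) $ s) = (\<lambda>t. F (y + t *\<^sub>R h') $ s)"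
    using cw unfolding componentwise_def by blast
  then have "(\<lambda>t. J (t *\<^sub>R h) $ s) = (\<lambda>t. J (t *\<^sub>R h') $ s)"
    using has_derivative_unique[OF line[of h]] line[of h'] by metis
  then have "J h $ s = J h' $ s" by (metis scaleR_one)
  also have "\<dots> = h $ s * J (axis s 1) $ s" unfolding h'_def using lin by (simp add: linear_scale)
  finally show ?thesis .
qed

lemma componentwise_derivative_self_adjoint:
  fixes F :: "real^'n \<Rightarrow> real^'n"
  assumes "componentwise F" "(F has_derivative J) (at y)"
  shows "self_adjoint J"
proof -
  have "J x $ s * y $ s = x $ s * J y $ s" for x y s
    using componentwise_derivative_diagonal[OF assms, of x s] componentwise_derivative_diagonal[OF assms, of y s]
    by simp
  then show ?thesis unfolding self_adjoint_def inner_vec_def inner_real_def by simp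
qed

lemma inner_matrix_vector_mult_transpose:
  fixes B :: "real^'n^'m"
  shows "u \<bullet> (B *v w) = (transpose B *v u) \<bullet> w"
  by (simp add: dot_lmul_matrix)

lemma transpose_bij_betw_range:
  fixes B :: "real^'n^'m"
  assumes inj: "inj ((*v) B)"
  shows "bij_betw ((*v) (transpose B)) (range ((*v) B)) UNIV"
proof -
  have kernel_meets_range: "x = 0" if x: "x \<in> range ((*v) B)" "transpose B *v x = 0" for x
  proof -
    obtain z where "x = B *v z" using x(1) by blast
    then have "x \<bullet> x = (transpose B *v x) \<bullet> z" by (simp add: inner_matrix_vector_mult_transpose)
    then show ?thesis using x(2) by simp
  qed
  have lin: "linear (\<lambda>z. transpose B *v (B *v z))"
    by (rule linear_compose[OF matrix_vector_mul_linear matrix_vector_mul_linear, unfolded o_def])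
  moreover have "inj (\<lambda>z. transpose B *v (B *v z))"
    using inj kernel_meets_range
    unfolding linear_injective_0[OF lin] linear_injective_0[OF matrix_vector_mul_linear] by blast
  ultimately have "surj (\<lambda>z. transpose B *v (B *v z))" by (rule linear_inj_imp_surj)
  then have "(*v) (transpose B) ` range ((*v) B) = UNIV" by (simp add: image_image)
  moreover have "subspace (range ((*v) B))"
    by (rule linear_subspace_image[OF matrix_vector_mul_linear subspace_UNIV])
  then have "inj_on ((*v) (transpose B)) (range ((*v) B))"
    using kernel_meets_range by (simp add: linear_injective_on_subspace_0[OF matrix_vector_mul_linear])
  ultimately show ?thesis by (simp add: bij_betw_def)
qed

lemma inertia_transpose_sandwich:
  fixes B :: "real^'n^'m" and J :: "real^'n \<Rightarrow> real^'n"
  assumes J: "self_adjoint J" and inj: "inj ((*v) B)"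
  shows "inertia (\<lambda>h. B *v J (transpose B *v h)) (range ((*v) B)) = inertia J UNIV"
proof (rule sylvester_law_of_inertia)
  show "self_adjoint (\<lambda>h. B *v J (transpose B *v h))"
    unfolding self_adjoint_def
  proof (intro allI)
    fix u v :: "real^'m"
    have "(B *v J (transpose B *v u)) \<bullet> v = J (transpose B *v u) \<bullet> (transpose B *v v)"
      by (metis inner_commute inner_matrix_vector_mult_transpose)
    also have "\<dots> = (transpose B *v u) \<bullet> J (transpose B *v v)"
      using J unfolding self_adjoint_def by blast
    also have "\<dots> = u \<bullet> (B *v J (transpose B *v v))"
      by (metis inner_matrix_vector_mult_transpose)
    finally show "(B *v J (transpose B *v u)) \<bullet> v = u \<bullet> (B *v J (transpose B *v v))" .
  qed
  show "subspace (range ((*v) B))"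
    by (rule linear_subspace_image[OF matrix_vector_mul_linear subspace_UNIV])
  show "(\<lambda>h. B *v J (transpose B *v h)) ` range ((*v) B) \<subseteq> range ((*v) B)" by blast
  show "self_adjoint J" by (fact J)
  show "subspace (UNIV :: (real^'n) set)" by (fact subspace_UNIV)
  show "J ` UNIV \<subseteq> UNIV" by blast
  show "linear ((*v) (transpose B))" by (fact matrix_vector_mul_linear)
  show "bij_betw ((*v) (transpose B)) (range ((*v) B)) UNIV"
    using inj by (rule transpose_bij_betw_range)
  show "(transpose B *v v) \<bullet> J (transpose B *v v) = v \<bullet> (B *v J (transpose B *v v))" for v
    by (metis inner_matrix_vector_mult_transpose)
qed

lemma frechet_derivative_transpose_sandwich:
  fixes B :: "real^'n^'m" and F :: "real^'n \<Rightarrow> real^'n"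
  assumes "F differentiable at (transpose B *v x)"
  shows "frechet_derivative (\<lambda>x. B *v F (transpose B *v x)) (at x)
    = (\<lambda>h. B *v frechet_derivative F (at (transpose B *v x)) (transpose B *v h))"
proof -
  have "((\<lambda>x. F (transpose B *v x)) has_derivative
      (\<lambda>h. frechet_derivative F (at (transpose B *v x)) (transpose B *v h))) (at x)"
    by (rule has_derivative_compose[OF bounded_linear_imp_has_derivative[OF matrix_vector_mul_bounded_linear]
          frechet_derivative_works[THEN iffD1, OF assms]])
  from has_derivative_compose[OF this bounded_linear_imp_has_derivative[OF matrix_vector_mul_bounded_linear[of B]]]
  show ?thesis by (rule frechet_derivative_at[symmetric])
qed

lemma zeros_transpose_sandwich_bij_betw:
  fixes B :: "real^'n^'m" and F :: "real^'n \<Rightarrow> real^'n"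
  assumes inj: "inj ((*v) B)"
  shows "bij_betw ((*v) (transpose B)) {x \<in> range ((*v) B). B *v F (transpose B *v x) = 0} {y. F y = 0}"
proof -
  have "F (transpose B *v x) = 0 \<longleftrightarrow> B *v F (transpose B *v x) = 0" for x
    using inj unfolding inj_def by (metis matrix_vector_mult_0_right)
  then have "bij_betw ((*v) (transpose B))
      {x \<in> range ((*v) B). B *v F (transpose B *v x) = 0} {y \<in> UNIV. F y = 0}"
    using transpose_bij_betw_range[OF inj] by (intro bij_betw_Collect)
  then show ?thesis by simp
qed

theorem mainTheorem11:
  fixes n d :: nat and X :: "nat set set"
    and enum_r :: "'r::finite \<Rightarrow> nat set" and enum_c :: "'c::finite \<Rightarrow> nat set"
    and F :: "real^'c \<Rightarrow> real^'c"
  assumes "simplicial_complex n X"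
    and "bij_betw enum_r UNIV (simplices X d)"
    and "bij_betw enum_c UNIV (simplices X (Suc d))"
    and "{z. boundary_matrix enum_r enum_c *v z = 0} = {0}"
    and "smooth F"
  shows "let B = boundary_matrix enum_r enum_c;
             G = (\<lambda>x. B *v F (transpose B *v x));
             V = range (\<lambda>z. B *v z)
         in \<exists>\<phi>. bij_betw \<phi> {x \<in> V. G x = 0} {y. F y = 0} \<and>
                (componentwise F \<longrightarrow>
                   (\<forall>x \<in> {x \<in> V. G x = 0}.
                      inertia (frechet_derivative G (at x)) V
                        = inertia (frechet_derivative F (at (\<phi> x))) UNIV))"
proof -
  define B where "B = boundary_matrix enum_r enum_c"
  define G where "G = (\<lambda>x. B *v F (transpose B *v x))"
  define V where "V = range (\<lambda>z. B *v z)"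
  have inj: "inj ((*v) B)"
    using assms(4) unfolding B_def linear_injective_0[OF matrix_vector_mul_linear] by blast
  have F': "(F has_derivative frechet_derivative F (at y)) (at y)" for y
    using assms(5) iter_dderiv.base frechet_derivative_works unfolding smooth_def by blast
  have "bij_betw ((*v) (transpose B)) {x \<in> V. G x = 0} {y. F y = 0}"
    unfolding V_def G_def using inj by (rule zeros_transpose_sandwich_bij_betw)
  moreover have "inertia (frechet_derivative G (at x)) V
      = inertia (frechet_derivative F (at (transpose B *v x))) UNIV" if "componentwise F" for x
    unfolding G_def V_def frechet_derivative_transpose_sandwich[OF differentiableI[OF F']]
    by (rule inertia_transpose_sandwich[OF componentwise_derivative_self_adjoint[OF that F'] inj])
  ultimately have "\<exists>\<phi>. bij_betw \<phi> {x \<in> V. G x = 0} {y. F y = 0} \<and>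
      (componentwise F \<longrightarrow> (\<forall>x \<in> {x \<in> V. G x = 0}.
         inertia (frechet_derivative G (at x)) V = inertia (frechet_derivative F (at (\<phi> x))) UNIV))"
    by blast
  then show ?thesis unfolding Let_def B_def G_def V_def .
qed

end
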